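(* Let $G$ be a connected graph on $n$ vertices with $m$ edges, diameter $D$, maximum degree $\Delta$ and minimum degree $\delta$, and let $H,H'$ be connected graphs on the same vertex set. Let $\lambda=\lambda(G,H)$ and $\lambda'=\lambda(G,H')$. Then $$\lambda'\le \frac{\Delta^2}{\delta^2}(1+S_G)\,\lambda,\qquad S_G=\left(\binom{n}{2}-m\right)D^2.$$
   Context: All graphs are finite and simple. For a graph $G$, $d_v$ denotes the degree of $v$, $u\sim v$ means adjacency, and $\mathrm{vol}(G)=\sum_v d_v$. For a metric space $(X,d)$ and $f:V(G)\to X$ set $R_f(G,X)=\frac{\mathrm{vol}(G)\sum_{u\sim v} d(f(u),f(v))^2}{\sum_{u,v} d(f(u),f(v))^2 d_u d_v}$, where the numerator sum is over edges of $G$ and the denominator sum over unordered pairs of vertices; $\lambda(G,X)=\inf_f R_f(G,X)$ over all $f$ with nonzero denominator. A connected graph $H$ is regarded as the metric space $(V(H),d_H)$ with shortest-path distance, and $\lambda(G,H)=\lambda(G,(V(H),d_H))$. *)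

theory Defs
  imports
    "HOL-Analysis.Abstract_Metric_Spaces"
    "HOL-Library.Extended_Real"
    "Graph_Theory.Graph_Theory"
begin

text \<open>
  Finite simple graphs are the locale \<^locale>\<open>pair_graph\<close>: finite, loop-free, symmetric sets of
  ordered pairs. An undirected edge is thus represented by its two opposite arcs.
\<close>

definition connected_graph :: "'a pair_pre_digraph \<Rightarrow> bool" where
  "connected_graph G \<longleftrightarrow> pair_graph G \<and> Digraph_Component.connected (with_proj G)"

definition edges :: "'a pair_pre_digraph \<Rightarrow> 'a set set" where
  "edges G = {{u, v} |u v. (u, v) \<in> parcs G}"

definition degree :: "'a pair_pre_digraph \<Rightarrow> 'a \<Rightarrow> nat" where
  "degree G v = out_degree (with_proj G) v"

definition max_degree :: "'a pair_pre_digraph \<Rightarrow> nat" where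
  "max_degree G = Max (degree G ` pverts G)"

definition min_degree :: "'a pair_pre_digraph \<Rightarrow> nat" where
  "min_degree G = Min (degree G ` pverts G)"

definition vol :: "'a pair_pre_digraph \<Rightarrow> nat" where
  "vol G = (\<Sum>v\<in>pverts G. degree G v)"

text \<open>The library's weighted shortest-path distance, with every arc of length one.\<close>

definition gdist :: "'a pair_pre_digraph \<Rightarrow> 'a \<Rightarrow> 'a \<Rightarrow> real" where
  "gdist G u v = real_of_ereal (wf_digraph.\<mu> (with_proj G) (\<lambda>_. 1) u v)"

definition graph_diameter :: "'a pair_pre_digraph \<Rightarrow> real" where
  "graph_diameter G = Max {gdist G u v |u v. u \<in> pverts G \<and> v \<in> pverts G}"

text \<open>
  Each factor 1/2 turns a sum over ordered pairs into the sum over unordered pairs: every edge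
  occurs as two arcs, and the diagonal terms of the second sum are zero when \<open>d\<close> is a metric.
\<close>

definition edge_energy :: "'a pair_pre_digraph \<Rightarrow> ('b \<Rightarrow> 'b \<Rightarrow> real) \<Rightarrow> ('a \<Rightarrow> 'b) \<Rightarrow> real" where
  "edge_energy G d f = (\<Sum>(u, v)\<in>parcs G. (d (f u) (f v))\<^sup>2) / 2"

definition pair_energy :: "'a pair_pre_digraph \<Rightarrow> ('b \<Rightarrow> 'b \<Rightarrow> real) \<Rightarrow> ('a \<Rightarrow> 'b) \<Rightarrow> real" where
  "pair_energy G d f =
     (\<Sum>u\<in>pverts G. \<Sum>v\<in>pverts G. (d (f u) (f v))\<^sup>2 * real (degree G u) * real (degree G v)) / 2"

definition rayleigh :: "'a pair_pre_digraph \<Rightarrow> ('b \<Rightarrow> 'b \<Rightarrow> real) \<Rightarrow> ('a \<Rightarrow> 'b) \<Rightarrow> real" where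
  "rayleigh G d f = real (vol G) * edge_energy G d f / pair_energy G d f"

text \<open>
  The infimum is taken in the extended reals, so that it is \<open>\<infinity>\<close> if no map has a nonzero
  denominator (for instance if the target has only one point).
\<close>

definition metric_gap :: "'a pair_pre_digraph \<Rightarrow> 'b set \<Rightarrow> ('b \<Rightarrow> 'b \<Rightarrow> real) \<Rightarrow> ereal" where
  "metric_gap G X d =
     (INF f \<in> {f. f \<in> pverts G \<rightarrow> X \<and> pair_energy G d f \<noteq> 0}. ereal (rayleigh G d f))"

definition graph_gap :: "'a pair_pre_digraph \<Rightarrow> 'b pair_pre_digraph \<Rightarrow> ereal" where
  "graph_gap G H = metric_gap G (pverts H) (gdist H)"

lemma gdist_attained:
  assumes "connected_graph G" "u \<in> pverts G" "v \<in> pverts G"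
  shows "\<exists>p. pre_digraph.awalk (with_proj G) u p v \<and> gdist G u v = real (length p) \<and>
    (\<forall>q. pre_digraph.awalk (with_proj G) u q v \<longrightarrow> length p \<le> length q)"
proof -
  interpret pair_graph G using assms(1) by (simp add: connected_graph_def)
  have "strongly_connected (with_proj G)"
    using assms(1) symmetric_connected_imp_strongly_connected sym_arcs
    by (simp add: connected_graph_def)
  then have "u \<rightarrow>\<^sup>*\<^bsub>with_proj G\<^esub> v" using assms by auto
  then obtain p where p: "apath u p v" "\<mu> (\<lambda>_. 1) u v = awalk_cost (\<lambda>_. 1) p"
    using min_cost_awalk[of u v "\<lambda>_. 1"] by auto
  have c: "awalk_cost (\<lambda>_. 1) q = real (length q)" for q
    by (induction q) auto
  have w: "awalk u p v" using p(1) by (simp add: apath_def)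
  have "gdist G u v = real (length p)" by (simp add: gdist_def p(2) c)
  moreover have "length p \<le> length q" if "awalk u q v" for q
    using min_cost_le_walk_cost[OF that, of "\<lambda>_. 1"] by (simp add: p(2) c)
  ultimately show ?thesis using w by blast
qed

lemma awalk_rev:
  assumes "connected_graph G" "pre_digraph.awalk (with_proj G) u p v"
  shows "\<exists>q. pre_digraph.awalk (with_proj G) v q u \<and> length q = length p"
proof -
  interpret pair_graph G using assms(1) by (simp add: connected_graph_def)
  from assms(2) show ?thesis
  proof (induction p arbitrary: u)
    case Nil then show ?case by (auto simp: awalk_Nil_iff)
  next
    case (Cons e p)
    then have e: "e \<in> parcs G" "fst e = u" and "awalk (snd e) p v"
      by (auto simp: awalk_Cons_iff)
    then obtain q where q: "awalk v q (snd e)" "length q = length p" using Cons.IH by blast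
    have "(snd e, u) \<in> parcs G"
      using e pair_sym_arcs by (metis prod.collapse symmetric_def symD with_proj_simps(3))
    then have "awalk (snd e) [(snd e, u)] u"
      by (auto simp: awalk_Cons_iff awalk_Nil_iff dest: in_arcsD1 in_arcsD2)
    with q show ?case using awalk_appendI by (metis length_Cons length_append_singleton)
  qed
qed

lemma Metric_space_gdist:
  assumes "connected_graph G"
  shows "Metric_space (pverts G) (gdist G)"
proof -
  interpret pair_graph G using assms by (simp add: connected_graph_def)
  have nonneg: "gdist G u v \<ge> 0" for u v
    unfolding gdist_def \<mu>_def
    by (intro real_of_ereal_pos INF_greatest) (auto intro!: pos_cost_pos_awalk_cost)
  have le: "gdist G u v \<le> gdist G v u" if uv: "u \<in> pverts G" "v \<in> pverts G" for u v
  proof -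
    obtain p where p: "awalk u p v" "gdist G u v = real (length p)"
        "\<And>q. awalk u q v \<Longrightarrow> length p \<le> length q"
      using gdist_attained[OF assms uv] by blast
    obtain q where q: "awalk v q u" "gdist G v u = real (length q)"
        "\<And>q. awalk v q u \<Longrightarrow> length q \<le> length q"
      using gdist_attained[OF assms uv(2,1)] by blast
    obtain r where "awalk u r v" "length r = length q"
      using awalk_rev[OF assms q(1)] by blast
    with p(2) p(3)[of r] q(2) show ?thesis by simp
  qed
  have zero: "gdist G u v = 0 \<longleftrightarrow> u = v" if uv: "u \<in> pverts G" "v \<in> pverts G" for u v
  proof -
    obtain p where p: "awalk u p v" "gdist G u v = real (length p)"
        "\<And>q. awalk u q v \<Longrightarrow> length p \<le> length q"
      using gdist_attained[OF assms uv] by blast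
    have "p = []" if "u = v"
      using p(3)[of "[]"] that uv by (simp add: awalk_Nil_iff)
    with p show ?thesis by (auto simp: awalk_Nil_iff)
  qed
  have tri: "gdist G u w \<le> gdist G u v + gdist G v w"
    if uvw: "u \<in> pverts G" "v \<in> pverts G" "w \<in> pverts G" for u v w
  proof -
    obtain p where p: "awalk u p w" "gdist G u w = real (length p)"
        "\<And>q. awalk u q w \<Longrightarrow> length p \<le> length q"
      using gdist_attained[OF assms uvw(1,3)] by blast
    obtain q where q: "awalk u q v" "gdist G u v = real (length q)"
        "\<And>q. awalk u q v \<Longrightarrow> length q \<le> length q"
      using gdist_attained[OF assms uvw(1,2)] by blast
    obtain r where r: "awalk v r w" "gdist G v w = real (length r)"
        "\<And>q. awalk v q w \<Longrightarrow> length r \<le> length q"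
      using gdist_attained[OF assms uvw(2,3)] by blast
    from p(3)[OF awalk_appendI[OF q(1) r(1)]] p q r show ?thesis by simp
  qed
  have outside: "gdist G u v = 0" if "u \<notin> pverts G \<or> v \<notin> pverts G" for u v
  proof -
    have "{p. awalk u p v} = {}" using that by auto
    then show ?thesis by (simp add: gdist_def \<mu>_def top_ereal_def)
  qed
  have sym: "gdist G u v = gdist G v u" for u v
    using le[of u v] le[of v u] outside[of u v] outside[of v u] by fastforce
  show ?thesis
    using nonneg sym zero tri by unfold_locales
qed

end

theory Submission
  imports Defs
begin

text \<open>
  One map \<open>f\<close> serves both targets. Comparing the sum over all pairs with the sum over edges
  alone gives \<open>\<delta>\<^sup>2 edge_energy \<le> pair_energy\<close> in every metric. Conversely, along a shortest path a
  non-adjacent pair is at distance at most \<open>D\<close> times the longest image of an edge, so the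
  non-edges contribute at most \<open>S * edge_energy\<close> and \<open>pair_energy \<le> \<Delta>\<^sup>2 (1 + S) edge_energy\<close>.
  Hence every Rayleigh quotient lies between \<open>vol / (\<Delta>\<^sup>2 (1 + S))\<close> and \<open>vol / \<delta>\<^sup>2\<close>.
\<close>

section \<open>Counting arcs and non-adjacent pairs\<close>

lemma parcs_flip:
  assumes "connected_graph G" "(u, v) \<in> parcs G"
  shows "(v, u) \<in> parcs G"
proof -
  interpret pair_graph G using assms(1) by (simp add: connected_graph_def)
  show ?thesis using assms(2) pair_sym_arcs by (auto simp: symmetric_def dest: symD)
qed

text \<open>Forgetting orientation is two-to-one: the fibre over \<open>{u, v}\<close> consists of
  \<open>(u, v)\<close> and \<open>(v, u)\<close>, which differ because there are no loops.\<close>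

lemma card_parcs_eq:
  assumes "connected_graph G"
  shows "card (parcs G) = 2 * card (edges G)"
proof -
  interpret pair_graph G using assms by (simp add: connected_graph_def)
  let ?g = "\<lambda>a. {fst a, snd a}"
  have img: "?g ` parcs G = edges G" by (force simp: edges_def)
  have fib: "card {a \<in> parcs G. ?g a = e} = 2" if "e \<in> edges G" for e
  proof -
    obtain u v where uv: "e = {u, v}" "(u, v) \<in> parcs G"
      using \<open>e \<in> edges G\<close> by (auto simp: edges_def)
    have "u \<noteq> v" using no_loops[of "(u, v)"] uv(2) by auto
    moreover have "{a \<in> parcs G. ?g a = e} = {(u, v), (v, u)}"
      using uv parcs_flip[OF assms uv(2)] by (auto simp: doubleton_eq_iff)
    ultimately show ?thesis by simp
  qed
  have "card (parcs G) = (\<Sum>e\<in>?g ` parcs G. \<Sum>a | a \<in> parcs G \<and> ?g a = e. 1)"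
    using sum.image_gen[of "parcs G" "\<lambda>_. 1::nat" ?g] by simp
  also have "\<dots> = 2 * card (edges G)" unfolding img using fib by simp
  finally show ?thesis .
qed

text \<open>Interprets the first factor of \<open>S\<close>: it is half the number of ordered pairs
  of distinct non-adjacent vertices. Besides the counting itself, this yields
  \<open>S \<ge> 0\<close>.\<close>

lemma card_non_adjacent:
  assumes "connected_graph G"
  shows "real (card (pverts G \<times> pverts G - parcs G - Id)) =
    2 * (real (card (pverts G) choose 2) - real (card (edges G)))"
proof -
  interpret pair_graph G using assms by (simp add: connected_graph_def)
  let ?n = "card (pverts G)"
  let ?O = "pverts G \<times> pverts G - Id"
  have "?O = (SIGMA u:pverts G. pverts G - {u})" by auto
  then have c: "card ?O = ?n * (?n - 1)" by simp
  have sub: "parcs G \<subseteq> ?O" using no_loops in_arcsD1 in_arcsD2 by fastforce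
  have "2 * (?n choose 2) = ?n * (?n - 1)"
    using even_mult_iff[of ?n "?n - 1"] by (cases ?n) (simp_all add: choose_two)
  with c have c2: "card ?O = 2 * (?n choose 2)" by simp
  have "pverts G \<times> pverts G - parcs G - Id = ?O - parcs G" by auto
  moreover have "card (?O - parcs G) = card ?O - card (parcs G)"
    using sub by (intro card_Diff_subset) auto
  \<comment> \<open>Makes the natural-number subtraction exact, so that it survives the passage to
    the reals.\<close>
  moreover have "card (parcs G) \<le> card ?O" using sub by (intro card_mono) auto
  ultimately show ?thesis by (simp add: c2 card_parcs_eq[OF assms])
qed

section \<open>Bounds on distances and degrees\<close>

lemma gdist_le_diameter:
  assumes "connected_graph G" "u \<in> pverts G" "v \<in> pverts G"
  shows "gdist G u v \<le> graph_diameter G"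
proof -
  interpret pair_graph G using assms by (simp add: connected_graph_def)
  have "{gdist G u v |u v. u \<in> pverts G \<and> v \<in> pverts G} =
      (\<lambda>(u, v). gdist G u v) ` (pverts G \<times> pverts G)" by auto
  then have "finite {gdist G u v |u v. u \<in> pverts G \<and> v \<in> pverts G}" by simp
  then show ?thesis unfolding graph_diameter_def using assms by (intro Max_ge) auto
qed

text \<open>A walk to some second vertex is nonempty, and its first arc leaves
  \<open>u\<close>.\<close>

lemma degree_pos:
  assumes "connected_graph G" "card (pverts G) \<ge> 2" "u \<in> pverts G"
  shows "degree G u > 0"
proof -
  interpret pair_graph G using assms by (simp add: connected_graph_def)
  obtain v where v: "v \<in> pverts G" "v \<noteq> u"
    using assms(2) by (metis One_nat_def card_1_singleton_iff card_le_Suc0_iff_eq finite_verts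
        assms(3) not_less_eq_eq numeral_2_eq_2 with_proj_simps(1))
  obtain p where p: "awalk u p v" using gdist_attained[OF assms(1,3) v(1)] by blast
  with v(2) obtain e q where "p = e # q" by (cases p) (auto simp: awalk_Nil_iff)
  with p have "e \<in> out_arcs (with_proj G) u" by (auto simp: awalk_Cons_iff)
  moreover have "finite (out_arcs (with_proj G) u)"
    by (rule finite_subset[of _ "parcs G"]) (auto simp: out_arcs_def)
  ultimately show ?thesis unfolding degree_def out_degree_def by (auto simp: card_gt_0_iff)
qed

lemma degree_le_max_degree:
  assumes "connected_graph G" "u \<in> pverts G"
  shows "degree G u \<le> max_degree G"
proof -
  interpret pair_graph G using assms by (simp add: connected_graph_def)
  show ?thesis unfolding max_degree_def using assms by simp
qed

lemma min_degree_le_degree: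
  assumes "connected_graph G" "u \<in> pverts G"
  shows "min_degree G \<le> degree G u"
proof -
  interpret pair_graph G using assms by (simp add: connected_graph_def)
  show ?thesis unfolding min_degree_def using assms by simp
qed

lemma min_degree_pos:
  assumes "connected_graph G" "card (pverts G) \<ge> 2"
  shows "min_degree G > 0"
proof -
  interpret pair_graph G using assms by (simp add: connected_graph_def)
  have "pverts G \<noteq> {}" using assms(2) by auto
  then show ?thesis unfolding min_degree_def using degree_pos[OF assms] by simp
qed

section \<open>Comparing the two energies for one metric\<close>

lemma edge_energy_le_pair_energy:
  assumes "connected_graph G"
  shows "(real (min_degree G))\<^sup>2 * edge_energy G d f \<le> pair_energy G d f"
proof -
  interpret pair_graph G using assms by (simp add: connected_graph_def)
  let ?q = "\<lambda>u v. (d (f u) (f v))\<^sup>2 :: real"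
  let ?\<delta> = "real (min_degree G)"
  have sub: "parcs G \<subseteq> pverts G \<times> pverts G" using in_arcsD1 in_arcsD2 by auto
  have "?\<delta>\<^sup>2 * (\<Sum>(u, v)\<in>parcs G. ?q u v) \<le> ?\<delta>\<^sup>2 * (\<Sum>(u, v)\<in>pverts G \<times> pverts G. ?q u v)"
    using sub by (intro mult_left_mono sum_mono2) auto
  also have "\<dots> = (\<Sum>(u, v)\<in>pverts G \<times> pverts G. ?q u v * (?\<delta> * ?\<delta>))"
    by (simp add: sum_distrib_left power2_eq_square split_def mult_ac)
  also have "\<dots> \<le> (\<Sum>(u, v)\<in>pverts G \<times> pverts G. ?q u v * (real (degree G u) * real (degree G v)))"
    using min_degree_le_degree[OF assms]
    by (intro sum_mono) (auto intro!: mult_left_mono mult_mono)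
  also have "\<dots> = 2 * pair_energy G d f"
    by (simp add: pair_energy_def sum.cartesian_product mult.assoc)
  finally show ?thesis by (simp add: edge_energy_def)
qed

text \<open>Both orientations of the edge occur among the arcs with equal summands, by symmetry of
  \<open>d\<close>; together they cancel the factor 1/2 in \<open>edge_energy\<close>.\<close>

lemma arc_le_edge_energy:
  assumes "connected_graph G" "Metric_space X d" "(u, v) \<in> parcs G"
  shows "(d (f u) (f v))\<^sup>2 \<le> edge_energy G d f"
proof -
  interpret pair_graph G using assms by (simp add: connected_graph_def)
  have ne: "u \<noteq> v" using no_loops[of "(u, v)"] assms(3) by auto
  have "(\<Sum>(u, v)\<in>{(u, v), (v, u)}. (d (f u) (f v))\<^sup>2) \<le> (\<Sum>(u, v)\<in>parcs G. (d (f u) (f v))\<^sup>2)"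
    using assms(3) parcs_flip[OF assms(1,3)] by (intro sum_mono2) auto
  then show ?thesis
    using ne by (simp add: edge_energy_def Metric_space.commute[OF assms(2), of "f v" "f u"])
qed

text \<open>Iterated triangle inequality in the target along the image of the walk.\<close>

lemma dist_le_length_awalk:
  assumes "connected_graph G" "Metric_space X d" "f \<in> pverts G \<rightarrow> X"
    and "\<And>u v. (u, v) \<in> parcs G \<Longrightarrow> d (f u) (f v) \<le> c"
    and "pre_digraph.awalk (with_proj G) u p v"
  shows "d (f u) (f v) \<le> real (length p) * c"
proof -
  interpret pair_graph G using assms by (simp add: connected_graph_def)
  interpret M: Metric_space X d by fact
  from assms(5) show ?thesis
  proof (induction p arbitrary: u)
    case Nil
    then have "u = v" "f v \<in> X" using assms(3) by (auto simp: awalk_Nil_iff)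
    then show ?case by (simp add: M.zero)
  next
    case (Cons e p)
    then have e: "e \<in> parcs G" "fst e = u" and w: "awalk (snd e) p v"
      by (auto simp: awalk_Cons_iff)
    have "u \<in> pverts G" "snd e \<in> pverts G" "v \<in> pverts G"
      using awalk_hd_in_verts[OF Cons.prems] awalk_hd_in_verts[OF w] awalk_last_in_verts[OF w]
      by simp_all
    then have "d (f u) (f v) \<le> d (f u) (f (snd e)) + d (f (snd e)) (f v)"
      using assms(3) by (intro M.triangle) auto
    also have "\<dots> \<le> c + real (length p) * c"
      using Cons.IH[OF w] assms(4)[of u "snd e"] e by (metis add_mono prod.collapse)
    finally show ?case by (simp add: algebra_simps)
  qed
qed

text \<open>A shortest walk in \<open>G\<close> has at most \<open>graph_diameter G\<close> arcs,
  and each of them is mapped to a distance of at most the square root of the edge energy. This is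
  the source of the squared diameter in \<open>S\<close>.\<close>

lemma dist_square_le_edge_energy:
  assumes "connected_graph G" "Metric_space X d" "f \<in> pverts G \<rightarrow> X"
    and "u \<in> pverts G" "v \<in> pverts G"
  shows "(d (f u) (f v))\<^sup>2 \<le> (graph_diameter G)\<^sup>2 * edge_energy G d f"
proof -
  interpret M: Metric_space X d by fact
  let ?E = "edge_energy G d f"
  have E: "?E \<ge> 0" by (auto simp: edge_energy_def intro!: sum_nonneg)
  obtain p where p: "pre_digraph.awalk (with_proj G) u p v" "gdist G u v = real (length p)"
    using gdist_attained[OF assms(1,4,5)] by blast
  have "d (f u) (f v) \<le> real (length p) * sqrt ?E"
    using arc_le_edge_energy[OF assms(1,2)]
    by (intro dist_le_length_awalk[OF assms(1-3) _ p(1)] real_le_rsqrt)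
  also have "\<dots> \<le> graph_diameter G * sqrt ?E"
    using gdist_le_diameter[OF assms(1,4,5)] p(2) E by (intro mult_right_mono) auto
  finally have "(d (f u) (f v))\<^sup>2 \<le> (graph_diameter G * sqrt ?E)\<^sup>2"
    by (intro power_mono) auto
  then show ?thesis using E by (simp add: power_mult_distrib)
qed

lemma pair_energy_le_edge_energy:
  assumes "connected_graph G" "Metric_space X d" "f \<in> pverts G \<rightarrow> X"
    and "S = (real (card (pverts G) choose 2) - real (card (edges G))) * (graph_diameter G)\<^sup>2"
  shows "pair_energy G d f \<le> (real (max_degree G))\<^sup>2 * (1 + S) * edge_energy G d f"
proof -
  interpret pair_graph G using assms by (simp add: connected_graph_def)
  interpret M: Metric_space X d by fact
  let ?q = "\<lambda>u v. (d (f u) (f v))\<^sup>2"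
  let ?\<Delta> = "real (max_degree G)" and ?E = "edge_energy G d f"
  let ?V = "pverts G \<times> pverts G"
  let ?N = "?V - parcs G - Id"
  have sub: "parcs G \<subseteq> ?V" using in_arcsD1 in_arcsD2 by auto
  \<comment> \<open>Only diagonal pairs are dropped, and \<open>d\<close> vanishes on them. Of the
    rest, arcs contribute exactly \<open>2 * ?E\<close>, and each pair in \<open>?N\<close> is
    estimated through the diameter.\<close>
  have "(\<Sum>(u, v)\<in>?V. ?q u v) = (\<Sum>(u, v)\<in>parcs G \<union> ?N. ?q u v)"
    using sub assms(3) by (intro sum.mono_neutral_right) (auto simp: Pi_iff M.zero)
  also have "\<dots> = 2 * ?E + (\<Sum>(u, v)\<in>?N. ?q u v)"
    by (subst sum.union_disjoint) (auto simp: edge_energy_def)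
  also have "(\<Sum>(u, v)\<in>?N. ?q u v) \<le> (\<Sum>_\<in>?N. (graph_diameter G)\<^sup>2 * ?E)"
    using dist_square_le_edge_energy[OF assms(1-3)] by (intro sum_mono) auto
  also have "\<dots> = 2 * S * ?E"
    by (simp add: card_non_adjacent[OF assms(1)] assms(4))
  finally have T: "(\<Sum>(u, v)\<in>?V. ?q u v) \<le> 2 * (1 + S) * ?E" by (simp add: algebra_simps)
  have "2 * pair_energy G d f = (\<Sum>(u, v)\<in>?V. ?q u v * (real (degree G u) * real (degree G v)))"
    by (simp add: pair_energy_def sum.cartesian_product mult.assoc)
  also have "\<dots> \<le> (\<Sum>(u, v)\<in>?V. ?q u v * (?\<Delta> * ?\<Delta>))"
    using degree_le_max_degree[OF assms(1)]
    by (intro sum_mono) (auto intro!: mult_left_mono mult_mono)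
  also have "\<dots> = ?\<Delta>\<^sup>2 * (\<Sum>(u, v)\<in>?V. ?q u v)"
    by (simp add: sum_distrib_left power2_eq_square split_def mult_ac)
  also have "\<dots> \<le> ?\<Delta>\<^sup>2 * (2 * (1 + S) * ?E)" using T by (intro mult_left_mono) auto
  also have "\<dots> = 2 * (?\<Delta>\<^sup>2 * (1 + S) * ?E)" by (simp only: mult_ac)
  finally show ?thesis by linarith
qed

section \<open>Rayleigh quotients and their infima\<close>

lemma pair_energy_nonneg: "pair_energy G d f \<ge> 0"
  by (auto simp: pair_energy_def intro!: sum_nonneg)

text \<open>All degrees are positive, so the denominator vanishes exactly for constant maps. This
  criterion does not mention the metric, so two metrics on \<open>X\<close> admit the same maps in
  the infimum.\<close>

lemma pair_energy_eq_0_iff: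
  assumes "connected_graph G" "card (pverts G) \<ge> 2" "Metric_space X d" "f \<in> pverts G \<rightarrow> X"
  shows "pair_energy G d f = 0 \<longleftrightarrow> (\<forall>u\<in>pverts G. \<forall>v\<in>pverts G. f u = f v)"
proof -
  interpret pair_graph G using assms by (simp add: connected_graph_def)
  interpret M: Metric_space X d by fact
  have fX: "f u \<in> X" if "u \<in> pverts G" for u using assms(4) that by auto
  have "pair_energy G d f = 0 \<longleftrightarrow>
      (\<forall>u\<in>pverts G. \<forall>v\<in>pverts G. (d (f u) (f v))\<^sup>2 * real (degree G u) * real (degree G v) = 0)"
    by (simp add: pair_energy_def sum_nonneg_eq_0_iff sum_nonneg del: mult_eq_0_iff)
  also have "\<dots> \<longleftrightarrow> (\<forall>u\<in>pverts G. \<forall>v\<in>pverts G. f u = f v)"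
    using degree_pos[OF assms(1,2)] fX by (intro ball_cong refl) (force simp: M.zero)
  finally show ?thesis .
qed

lemma rayleigh_comparison:
  assumes "connected_graph G" "card (pverts G) \<ge> 2"
    and "Metric_space X d" "f \<in> pverts G \<rightarrow> X" "pair_energy G d f \<noteq> 0" "pair_energy G d' f \<noteq> 0"
    and "S = (real (card (pverts G) choose 2) - real (card (edges G))) * (graph_diameter G)\<^sup>2"
  shows "rayleigh G d' f \<le>
    (real (max_degree G))\<^sup>2 / (real (min_degree G))\<^sup>2 * (1 + S) * rayleigh G d f"
proof -
  let ?\<Delta> = "real (max_degree G)" and ?\<delta> = "real (min_degree G)" and ?vol = "real (vol G)"
  have pos: "pair_energy G d f > 0" "pair_energy G d' f > 0"
    using assms(5,6) by (simp_all add: pair_energy_nonneg order.strict_iff_order)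
  have \<delta>: "?\<delta> > 0" using min_degree_pos[OF assms(1,2)] by simp
  have "rayleigh G d' f = ?vol * (edge_energy G d' f / pair_energy G d' f)"
    by (simp add: rayleigh_def)
  \<comment> \<open>The value \<open>?vol / ?\<delta>\<^sup>2\<close> involves neither metric and
    links the two quotients.\<close>
  also have "\<dots> \<le> ?vol * (1 / ?\<delta>\<^sup>2)"
    using edge_energy_le_pair_energy[OF assms(1), of d' f] pos \<delta>
    by (intro mult_left_mono) (simp_all add: field_simps)
  \<comment> \<open>The inserted factor is at least 1, by the upper bound on
    \<open>pair_energy G d f\<close>.\<close>
  also have "\<dots> \<le> ?vol * (1 / ?\<delta>\<^sup>2 * (?\<Delta>\<^sup>2 * (1 + S) * edge_energy G d f / pair_energy G d f))"
    using pair_energy_le_edge_energy[OF assms(1,3,4,7)] pos \<delta>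
    by (intro mult_left_mono) (simp_all add: divide_simps)
  also have "\<dots> = ?\<Delta>\<^sup>2 / ?\<delta>\<^sup>2 * (1 + S) * rayleigh G d f"
    by (simp add: rayleigh_def)
  finally show ?thesis .
qed

lemma metric_gap_comparison:
  assumes "connected_graph G" "card (pverts G) \<ge> 2"
    and "Metric_space X d" "Metric_space X d'"
    and "S = (real (card (pverts G) choose 2) - real (card (edges G))) * (graph_diameter G)\<^sup>2"
  shows "metric_gap G X d' \<le>
    ereal ((real (max_degree G))\<^sup>2 / (real (min_degree G))\<^sup>2 * (1 + S)) * metric_gap G X d"
proof -
  let ?C = "(real (max_degree G))\<^sup>2 / (real (min_degree G))\<^sup>2 * (1 + S)"
  let ?F = "\<lambda>d. {f. f \<in> pverts G \<rightarrow> X \<and> pair_energy G d f \<noteq> 0}"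
  have S: "S \<ge> 0" using card_non_adjacent[OF assms(1)] assms(5)
    by (simp add: zero_le_mult_iff)
  have "pverts G \<noteq> {}" using assms(2) by auto
  then have "max_degree G > 0"
    using degree_le_max_degree[OF assms(1)] degree_pos[OF assms(1,2)]
    by (meson ex_in_conv less_le_trans)
  then have C: "?C > 0"
    using S min_degree_pos[OF assms(1,2)] by (intro mult_pos_pos divide_pos_pos) auto
  \<comment> \<open>Lets a map chosen for \<open>d\<close> be used as a competitor for
    \<open>d'\<close>.\<close>
  have F: "?F d' = ?F d"
    using pair_energy_eq_0_iff[OF assms(1,2,3)] pair_energy_eq_0_iff[OF assms(1,2,4)] by blast
  \<comment> \<open>With the positive finite constant moved to the left, the right side can be
    minimised over \<open>f\<close>. An empty set of maps, where the gap is
    \<open>\<infinity>\<close>, is covered as well.\<close>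
  have le: "metric_gap G X d' / ereal ?C \<le> ereal (rayleigh G d f)" if f: "f \<in> ?F d" for f
  proof -
    have "metric_gap G X d' \<le> ereal (rayleigh G d' f)"
      unfolding metric_gap_def F using f by (intro INF_lower)
    also have "\<dots> \<le> ereal (?C * rayleigh G d f)"
      using rayleigh_comparison[OF assms(1,2,3) _ _ _ assms(5), of f d'] f F by auto
    finally show ?thesis using C by (simp add: ereal_divide_le_pos)
  qed
  then have "metric_gap G X d' / ereal ?C \<le> metric_gap G X d"
    unfolding metric_gap_def[of G X d] by (rule INF_greatest)
  then show ?thesis using C by (simp add: ereal_divide_le_pos)
qed

text \<open>Shortest-path distances of \<open>H\<close> and \<open>H'\<close> are two metrics on one
  vertex set, so the comparison of gaps applies. The bound \<open>n \<ge> 2\<close> excludes the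
  one-vertex graph: there both gaps are \<open>\<infinity>\<close>, while division by
  \<open>\<delta> = 0\<close> gives 0 and \<open>0 * \<infinity> = 0\<close>, so the formal
  inequality would fail.\<close>

theorem theorem5p1:
  fixes G :: "'a pair_pre_digraph"
    and H H' :: "'b pair_pre_digraph"
    and n m \<Delta> \<delta> :: nat
    and D S :: real
    and L L' :: ereal
  assumes "connected_graph G"
    and "n = card (pverts G)" and "n \<ge> 2"
    and "m = card (edges G)"
    and "D = graph_diameter G"
    and "\<Delta> = max_degree G"
    and "\<delta> = min_degree G"
    and "connected_graph H" and "connected_graph H'"
    and "pverts H = pverts H'"
    and "L = graph_gap G H"
    and "L' = graph_gap G H'"
    and "S = (real (n choose 2) - real m) * D\<^sup>2"
  shows "L' \<le> ereal ((real \<Delta>)\<^sup>2 / (real \<delta>)\<^sup>2 * (1 + S)) * L"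
  using metric_gap_comparison[of G "pverts H" "gdist H" "gdist H'" S] assms Metric_space_gdist
  by (metis graph_gap_def)

end
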